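(* Let $d\ge1$ and let $m>n\ge1$ be coprime integers. (a) For every $D\cong(y_{i,j})\in\mathcal{Y}(dn,dm)$, the move indices $\mathbf{p}_u$, $1\le u\le d-1$, are well-defined, and $$0<\mathbf{p}_1<\mathbf{p}_2<\cdots<\mathbf{p}_{d-1}\le(d-1)n.$$ (b) The map $$\Psi_d:\mathcal{Y}(dn,dm)\to\mathcal{A}dm(dn,dm):\ (y_{i,j})\mapsto(c_{i,j}):=\Psi_d((y_{i,j}))$$ is well-defined. (c) For every $D\in\mathcal{Y}(dn,dm)$, each $1\le u\le d-1$ and each $\mathbf{p}_u\le x<un$, we have $$\mathrm{rk}^{[d-u-1]}_{D,x}>\mathrm{rk}^{[d-u-1]}_{D,x+n}.$$
   Context: Notation: $\mathbb{N}=\{0,1,\dots\}$. Indices run over $0\le i\le d-1$, $0\le j\le n-1$; a family indexed by $(i,j)$ is also indexed by $x=in+j$. $\Gamma\subset\mathbb{N}$ is the semigroup (with $0$) generated by $dn,dm,dmn+1$; $\hat a_{i,j}=jdm+(dmn+1)i$; $a_{i,j}=a_{in+j}=mi+\lfloor jm/n\rfloor$. $\mathcal{A}dm(dn,dm)$ is the set of $\Delta\subset\mathbb{N}$ with $\min\Delta=0$, $\Gamma+\Delta\subset\Delta$, such that for every $0\le i\le d-1$ there is $a\in A(\Delta)$ with $a\equiv i\pmod d$ and $a+dm+1\in\Delta$, where $\Delta=\bigsqcup_{a\in A(\Delta)}(a+dn\mathbb{N})$. One writes uniquely $A(\Delta)=\{\hat a_{i,j}-dn\,c_{i,j}\}$,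 $0\le c_{i,j}\le a_{i,j}$, and identifies $\Delta$ with $(c_{i,j})$. $\mathcal{Y}(dn,dm)$ is the set of integer families $(y_x)_{0\le x\le dn-1}$ with $0\le y_x\le a_x$ and $y_x\le y_{x+1}$. Construction. Set $\mathrm{rk}^{[0]}_{D,x}=mx-ny_x$ for $0\le x\le dn-1$. For $u=d-1,d-2,\dots,1$, given $(\mathrm{rk}^{[d-u-1]}_{D,x})_{0\le x\le(u+1)n-1}$ define $$\mathbf{p}_u=\max\{0\le x\le un:\ \mathrm{rk}^{[d-u-1]}_{D,x}\le\mathrm{rk}^{[d-u-1]}_{D,x+n-1}+m\}$$ (well-defined means this set is nonempty), and for $0\le x\le un-1$ set $\mathrm{rk}^{[d-u]}_{D,x}=\mathrm{rk}^{[d-u-1]}_{D,x}$ if $x<\mathbf{p}_u$ and $\mathrm{rk}^{[d-u]}_{D,x}=\mathrm{rk}^{[d-u-1]}_{D,x+n}$ if $x\ge\mathbf{p}_u$. Put $\mathbf{i}_{j,u}=\min\{0\le i\le u:in+j\ge\mathbf{p}_u\}$, let $\mathbf{s}_{j,u}$ be the cycle $(\mathbf{i}_{j,u}\ \cdots\ u)$ on $\{0,\dots,d-1\}$ ($i\mapsto i+1$ for $\mathbf{i}_{j,u}\le i<u$, $u\mapsto\mathbf{i}_{j,u}$), and $\mathbf{s}_j=\mathbf{s}_{j,d-1}\circ\cdots\circ\mathbf{s}_{j,1}$. Then $\Psi_d((y_{i,j}))=(c_{i,j})$ with $c_{i,j}=y_{\mathbf{s}_j(i),j}-(\mathbf{s}_j(i)-i)m$.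 *)

theory Defs
  imports
    Complex_Main
    "HOL-Library.FuncSet"
    "HOL-Library.Disjoint_Sets"
    "HOL-Number_Theory.Cong"
    "HOL-Combinatorics.Cycles"
begin

definition Gam :: "nat \<Rightarrow> nat \<Rightarrow> nat \<Rightarrow> nat set" where
  "Gam d n m = {\<alpha> * (d * n) + \<beta> * (d * m) + \<gamma> * (d * m * n + 1) |\<alpha> \<beta> \<gamma>. True}"

definition a_hat :: "nat \<Rightarrow> nat \<Rightarrow> nat \<Rightarrow> nat \<Rightarrow> nat \<Rightarrow> nat" where
  "a_hat d n m i j = j * d * m + (d * m * n + 1) * i"

definition a_coord :: "nat \<Rightarrow> nat \<Rightarrow> nat \<Rightarrow> nat \<Rightarrow> nat" where
  "a_coord n m i j = m * i + nat \<lfloor>real (j * m) / real n\<rfloor>"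

text \<open>\<open>is_generators N \<Delta> A\<close>: the set \<open>\<Delta>\<close> is the disjoint union of the progressions
  \<open>a + N\<nat>\<close>, \<open>a \<in> A\<close>. For \<open>N > 0\<close> there is at most one such \<open>A\<close>;
  with \<open>N = dn\<close> it is \<open>A(\<Delta>)\<close>.\<close>

definition is_generators :: "nat \<Rightarrow> nat set \<Rightarrow> nat set \<Rightarrow> bool" where
  "is_generators N \<Delta> A \<longleftrightarrow>
     \<Delta> = (\<Union>a\<in>A. {a + N * k |k. True}) \<and>
     disjoint_family_on (\<lambda>a. {a + N * k |k. True}) A"

definition Adm :: "nat \<Rightarrow> nat \<Rightarrow> nat \<Rightarrow> nat set set" where
  "Adm d n m = {\<Delta>. 0 \<in> \<Delta> \<and> (\<forall>g\<in>Gam d n m. \<forall>x\<in>\<Delta>. g + x \<in> \<Delta>) \<and>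
     (\<exists>A. is_generators (d * n) \<Delta> A \<and>
        (\<forall>i<d. \<exists>a\<in>A. [a = i] (mod d) \<and> a + d * m + 1 \<in> \<Delta>))}"

text \<open>The identification of \<open>\<Delta>\<close> with its coordinates \<open>(c\<^sub>i\<^sub>,\<^sub>j)\<close>; only the values of \<open>c\<close> at
  \<open>i < d\<close>, \<open>j < n\<close> matter.\<close>

definition has_coords :: "nat \<Rightarrow> nat \<Rightarrow> nat \<Rightarrow> nat set \<Rightarrow> (nat \<Rightarrow> nat \<Rightarrow> int) \<Rightarrow> bool" where
  "has_coords d n m \<Delta> c \<longleftrightarrow>
     (\<forall>i<d. \<forall>j<n. 0 \<le> c i j \<and> c i j \<le> int (a_coord n m i j)) \<and>
     (\<exists>A. is_generators (d * n) \<Delta> A \<and>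
        int ` A = {int (a_hat d n m i j) - int (d * n) * c i j |i j. i < d \<and> j < n})"

text \<open>Families are indexed by \<open>x = i * n + j\<close>, so that \<open>i = x div n\<close> and \<open>j = x mod n\<close>.\<close>

definition Y :: "nat \<Rightarrow> nat \<Rightarrow> nat \<Rightarrow> (nat \<Rightarrow> int) set" where
  "Y d n m = {y \<in> (\<Pi>\<^sub>E x\<in>{..<d * n}. {0..int (a_coord n m (x div n) (x mod n))}).
     \<forall>x. x + 1 < d * n \<longrightarrow> y x \<le> y (x + 1)}"

text \<open>\<open>move_set n m u r\<close> is the set whose maximum is \<open>p\<^sub>u\<close>, when \<open>r\<close> is the rank family of
  upper index \<open>d - u - 1\<close>.\<close>

definition move_set :: "nat \<Rightarrow> nat \<Rightarrow> nat \<Rightarrow> (nat \<Rightarrow> int) \<Rightarrow> nat set" where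
  "move_set n m u r = {x. x \<le> u * n \<and> r x \<le> r (x + n - 1) + int m}"

text \<open>\<open>rk d n m y k\<close> is the rank family of upper index \<open>k\<close>; it is meaningful only for
  \<open>x < (d - k) * n\<close>. The step from \<open>k\<close> to \<open>Suc k\<close> uses \<open>u = d - Suc k\<close>.\<close>

primrec rk :: "nat \<Rightarrow> nat \<Rightarrow> nat \<Rightarrow> (nat \<Rightarrow> int) \<Rightarrow> nat \<Rightarrow> nat \<Rightarrow> int" where
  "rk d n m y 0 = (\<lambda>x. int m * int x - int n * y x)"
| "rk d n m y (Suc k) =
     (\<lambda>x. if x < Max (move_set n m (d - Suc k) (rk d n m y k))
          then rk d n m y k x else rk d n m y k (x + n))"

definition move_index :: "nat \<Rightarrow> nat \<Rightarrow> nat \<Rightarrow> (nat \<Rightarrow> int) \<Rightarrow> nat \<Rightarrow> nat" where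
  "move_index d n m y u = Max (move_set n m u (rk d n m y (d - u - 1)))"

definition row_set :: "nat \<Rightarrow> nat \<Rightarrow> nat \<Rightarrow> (nat \<Rightarrow> int) \<Rightarrow> nat \<Rightarrow> nat \<Rightarrow> nat set" where
  "row_set d n m y j u = {i. i \<le> u \<and> i * n + j \<ge> move_index d n m y u}"

definition row_index :: "nat \<Rightarrow> nat \<Rightarrow> nat \<Rightarrow> (nat \<Rightarrow> int) \<Rightarrow> nat \<Rightarrow> nat \<Rightarrow> nat" where
  "row_index d n m y j u = Min (row_set d n m y j u)"

definition s_cycle :: "nat \<Rightarrow> nat \<Rightarrow> nat \<Rightarrow> (nat \<Rightarrow> int) \<Rightarrow> nat \<Rightarrow> nat \<Rightarrow> nat \<Rightarrow> nat" where
  "s_cycle d n m y j u = cycle_of_list [row_index d n m y j u..<Suc u]"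

text \<open>The fold applies \<open>s_cycle \<dots> j 1\<close> first and \<open>s_cycle \<dots> j (d - 1)\<close> last.\<close>

definition s_perm :: "nat \<Rightarrow> nat \<Rightarrow> nat \<Rightarrow> (nat \<Rightarrow> int) \<Rightarrow> nat \<Rightarrow> nat \<Rightarrow> nat" where
  "s_perm d n m y j = fold (\<lambda>u f. s_cycle d n m y j u \<circ> f) [1..<d] id"

definition Psi :: "nat \<Rightarrow> nat \<Rightarrow> nat \<Rightarrow> (nat \<Rightarrow> int) \<Rightarrow> nat \<Rightarrow> nat \<Rightarrow> int" where
  "Psi d n m y i j =
     y (s_perm d n m y j i * n + j) - (int (s_perm d n m y j i) - int i) * int m"

end

theory Submission
  imports Defs
begin

text \<open>
  The proof rests on one invariant, \<open>rank_seq\<close>: a rank family starts with \<open>0\<close>, is nonnegative,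
  has \<open>r x\<close> congruent to \<open>mx\<close> modulo \<open>n\<close>, and grows by at most \<open>m\<close> per step. The
  initial family \<open>mx - n y\<^sub>x\<close> has these properties precisely because
  \<open>0 \<le> y\<^sub>x \<le> a\<^sub>x\<close> and \<open>y\<close> is nondecreasing. Passing to the next family cuts out the window
  \<open>p, \<dots>, p + n - 1\<close>, where \<open>p = p\<^sub>u\<close> is the last position with
  \<open>r p \<le> r (p + n - 1) + m\<close>. Since every later position violates this inequality while a single
  step gains at most \<open>m\<close>, the ranks decrease strictly along each class modulo \<open>n\<close> from \<open>p\<close>
  on. This is the last claim of the theorem, and it also bounds the step across the gap
  left by the cut, so that the invariant survives (\<open>rank_seq_remove_window\<close>). Positions from
  \<open>p\<close> on in the new family are positions beyond \<open>p\<close> in the old one, so the next move index is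
  smaller.

  For the map, write \<open>b\<^sub>i\<^sub>,\<^sub>j\<close> for the initial rank at row \<open>s\<^sub>j(i)\<close> and column \<open>j\<close>. Then
  \<open>n c\<^sub>i\<^sub>,\<^sub>j = m (in + j) - b\<^sub>i\<^sub>,\<^sub>j\<close>, and the generator with coordinate \<open>c\<^sub>i\<^sub>,\<^sub>j\<close> is simply
  \<open>d b\<^sub>i\<^sub>,\<^sub>j + i\<close>. The cycles record the successive cuts, and row \<open>u\<close> of \<open>b\<close> turns out
  to be the window cut out at level \<open>u\<close> (\<open>rk_s_perm_eq_window\<close>); at level \<open>0\<close> the window,
  with \<open>p\<^sub>0 = 0\<close>, is all that is left. Let \<open>B\<^sub>u\<close> be the set generated by row \<open>u\<close>
  under adding \<open>n\<close>, so that the set sought is the union of the \<open>d B\<^sub>u + u\<close>.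

  The conditions on this union become statements about the \<open>B\<^sub>u\<close>.
  The definition of \<open>p\<^sub>u\<close> is exactly what closes the window up cyclically, so
  \<open>B\<^sub>u + m \<subseteq> B\<^sub>u\<close> (\<open>window_rank_Suc\<close>). Stepping from position \<open>p\<^sub>u\<^sub>+\<^sub>1 - 1\<close> to
  \<open>p\<^sub>u\<^sub>+\<^sub>1\<close> gives an element of row \<open>u\<close> that is sent into \<open>B\<^sub>u\<^sub>+\<^sub>1\<close> by adding \<open>m\<close>
  (\<open>window_rank_link\<close>); this is admissibility for \<open>i = u\<close>, and together with closure under
  \<open>m\<close> it yields \<open>B\<^sub>u + mn \<subseteq> B\<^sub>u\<^sub>+\<^sub>1\<close>. The passage from the last row back to row \<open>0\<close> is free,
  because \<open>B\<^sub>0\<close> contains \<open>0\<close> and hence every multiple of \<open>n\<close> and every integer from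
  \<open>mn\<close> on. Finally \<open>b \<ge> 0\<close> and the bound \<open>b\<^sub>i\<^sub>,\<^sub>j \<le> m (in + j)\<close>, which these inclusions imply,
  are the two bounds required of \<open>c\<^sub>i\<^sub>,\<^sub>j\<close>.
\<close>

section \<open>Rank sequences and the removal of a window\<close>

definition rank_seq :: "nat \<Rightarrow> nat \<Rightarrow> nat \<Rightarrow> (nat \<Rightarrow> int) \<Rightarrow> bool" where
  "rank_seq n m L r \<longleftrightarrow> r 0 = 0 \<and>
     (\<forall>x<L. 0 \<le> r x \<and> [r x = int m * int x] (mod int n)) \<and>
     (\<forall>x. Suc x < L \<longrightarrow> r (Suc x) \<le> r x + int m)"

lemma rank_seq_zero: "rank_seq n m L r \<Longrightarrow> r 0 = 0"
  and rank_seq_nonneg: "rank_seq n m L r \<Longrightarrow> x < L \<Longrightarrow> 0 \<le> r x"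
  and rank_seq_cong: "rank_seq n m L r \<Longrightarrow> x < L \<Longrightarrow> [r x = int m * int x] (mod int n)"
  and rank_seq_Suc: "rank_seq n m L r \<Longrightarrow> Suc x < L \<Longrightarrow> r (Suc x) \<le> r x + int m"
  by (auto simp: rank_seq_def)

definition remove_window :: "nat \<Rightarrow> nat \<Rightarrow> (nat \<Rightarrow> int) \<Rightarrow> nat \<Rightarrow> int" where
  "remove_window n p r = (\<lambda>x. if x < p then r x else r (x + n))"

abbreviation window_start :: "nat \<Rightarrow> nat \<Rightarrow> nat \<Rightarrow> (nat \<Rightarrow> int) \<Rightarrow> nat" where
  "window_start n m u r \<equiv> Max (move_set n m u r)"

lemma finite_move_set: "finite (move_set n m u r)"
  unfolding move_set_def by (rule finite_subset[of _ "{..u * n}"]) auto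

lemma zero_in_move_set:
  assumes "rank_seq n m (Suc u * n) r" and "n \<ge> 1"
  shows "0 \<in> move_set n m u r"
proof -
  have "0 \<le> r (n - 1)"
    using assms by (intro rank_seq_nonneg[OF assms(1)]) auto
  then show ?thesis
    using rank_seq_zero[OF assms(1)] by (simp add: move_set_def)
qed

lemma window_start_in_move_set:
  assumes "rank_seq n m (Suc u * n) r" and "n \<ge> 1"
  shows "window_start n m u r \<in> move_set n m u r"
  using zero_in_move_set[OF assms] finite_move_set by (metis Max_in empty_iff)

lemma window_start_le:
  assumes "rank_seq n m (Suc u * n) r" and "n \<ge> 1"
  shows "window_start n m u r \<le> u * n"
  using window_start_in_move_set[OF assms] by (simp add: move_set_def)

text \<open>The position \<open>1\<close> always belongs to the move set, because
  \<open>r 1 \<le> r 0 + m = m \<le> r n + m\<close>.\<close>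

lemma window_start_pos:
  assumes "rank_seq n m (Suc u * n) r" and "n \<ge> 1" and "u \<ge> 1"
  shows "0 < window_start n m u r"
proof -
  have "n < Suc u * n" "Suc 0 < Suc u * n"
    using assms(2,3) by (cases u; auto)+
  then have "0 \<le> r n" "r (Suc 0) \<le> r 0 + int m"
    using rank_seq_nonneg[OF assms(1)] rank_seq_Suc[OF assms(1)] by auto
  then have "1 \<in> move_set n m u r"
    using rank_seq_zero[OF assms(1)] assms(2,3) by (simp add: move_set_def)
  then have "1 \<le> window_start n m u r"
    using finite_move_set by (rule Max_ge[rotated])
  then show ?thesis by simp
qed

lemma drop_after_window_start:
  assumes "window_start n m u r < x" and "x \<le> u * n"
  shows "r (x + n - 1) + int m < r x"
proof -
  have "x \<notin> move_set n m u r"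
    using assms(1) Max_ge[OF finite_move_set, of x n m u r] by linarith
  then show ?thesis
    using assms(2) by (auto simp: move_set_def)
qed

text \<open>Maximality of the window start \<open>p\<close> at the position \<open>x + 1\<close> says that \<open>r\<close> has lost more
  than \<open>m\<close> by the position \<open>x + n\<close>, whereas the single step from \<open>x\<close> to \<open>x + 1\<close> can gain
  at most \<open>m\<close>.\<close>

lemma rank_decreases_by_period:
  assumes "rank_seq n m (Suc u * n) r" and "n \<ge> 1"
    and "window_start n m u r \<le> x" and "x < u * n"
  shows "r (x + n) < r x"
proof -
  have "r (Suc x + n - 1) + int m < r (Suc x)"
    using assms(3,4) by (intro drop_after_window_start[of n m u r "Suc x"]) auto
  moreover have "r (Suc x) \<le> r x + int m"
    using assms(2,4) by (intro rank_seq_Suc[OF assms(1)]) auto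
  ultimately show ?thesis by simp
qed

lemma rank_decreases_by_periods:
  assumes "rank_seq n m (Suc u * n) r" and "n \<ge> 1"
    and "window_start n m u r \<le> x" and "x + k * n < Suc u * n"
  shows "r (x + k * n) \<le> r x"
  using assms(4)
proof (induction k)
  case (Suc k)
  have "r (x + k * n + n) < r (x + k * n)"
  proof (rule rank_decreases_by_period[OF assms(1,2)])
    show "window_start n m u r \<le> x + k * n"
      using assms(3) by simp
    show "x + k * n < u * n"
      using Suc.prems by simp
  qed
  moreover have "r (x + k * n) \<le> r x"
  proof (rule Suc.IH)
    show "x + k * n < Suc u * n"
      using Suc.prems by simp
  qed
  ultimately show ?case by (simp add: algebra_simps)
qed simp

text \<open>The only bound that is not inherited is the one across the gap:
  \<open>r (p + n) < r p \<le> r (p - 1) + m\<close>. Here \<open>p > 0\<close> also keeps the entry \<open>r 0 = 0\<close>.\<close>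

lemma rank_seq_remove_window:
  assumes "rank_seq n m (Suc u * n) r" and "n \<ge> 1" and "u \<ge> 1"
  shows "rank_seq n m (u * n) (remove_window n (window_start n m u r) r)"
proof -
  define p where "p = window_start n m u r"
  have p: "0 < p" "p \<le> u * n"
    using window_start_pos[OF assms] window_start_le[OF assms(1,2)] by (simp_all add: p_def)
  have shift: "[r (x + n) = int m * int x] (mod int n)" if "x < u * n" for x
  proof -
    have "[r (x + n) = int m * int (x + n)] (mod int n)"
      using that by (intro rank_seq_cong[OF assms(1)]) auto
    then show ?thesis
      by (simp add: cong_def distrib_left)
  qed
  have gap: "remove_window n p r (Suc x) \<le> remove_window n p r x + int m"
    if x: "Suc x < u * n" for x
  proof -
    consider "Suc x < p" | "p = Suc x" | "p \<le> x" by linarith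
    then show ?thesis
    proof cases
      case 1
      then show ?thesis
        using rank_seq_Suc[OF assms(1)] x by (simp add: remove_window_def)
    next
      case 2
      have "r (Suc x + n) < r (Suc x)"
        using 2 x by (intro rank_decreases_by_period[OF assms(1,2)]) (auto simp: p_def)
      moreover have "r (Suc x) \<le> r x + int m"
        using rank_seq_Suc[OF assms(1)] x by simp
      ultimately show ?thesis
        using 2 by (simp add: remove_window_def)
    next
      case 3
      then show ?thesis
        using rank_seq_Suc[OF assms(1), of "x + n"] x by (simp add: remove_window_def)
    qed
  qed
  have "rank_seq n m (u * n) (remove_window n p r)"
    unfolding rank_seq_def
    using gap shift p rank_seq_zero[OF assms(1)] rank_seq_nonneg[OF assms(1)]
      rank_seq_cong[OF assms(1)]
    by (auto simp: remove_window_def)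
  then show ?thesis by (simp add: p_def)
qed

text \<open>A position \<open>x \<ge> p\<close> of the shortened sequence was the position \<open>x + n > p\<close> of the old one,
  so it was already excluded from the old move set.\<close>

lemma window_start_remove_less:
  assumes r: "rank_seq n m (Suc (Suc u) * n) r" and n: "n \<ge> 1"
  shows "window_start n m u (remove_window n (window_start n m (Suc u) r) r)
    < window_start n m (Suc u) r"
proof -
  define p r' where "p = window_start n m (Suc u) r" and "r' = remove_window n p r"
  have r': "rank_seq n m (Suc u * n) r'"
    using rank_seq_remove_window[OF r n] by (simp add: r'_def p_def)
  have in': "window_start n m u r' \<in> move_set n m u r'"
    by (rule window_start_in_move_set[OF r' n])
  have "\<not> p \<le> window_start n m u r'"
  proof
    define x where "x = window_start n m u r'"
    assume "p \<le> window_start n m u r'"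
    then have px: "p \<le> x" by (simp add: x_def)
    have x: "x \<le> u * n" "r' x \<le> r' (x + n - 1) + int m"
      using in' by (simp_all add: move_set_def x_def)
    have "r (x + n + n - 1) + int m < r (x + n)"
      using px x(1) n by (intro drop_after_window_start[of n m "Suc u" r "x + n"]) (auto simp: p_def)
    moreover have "r' x = r (x + n)" "r' (x + n - 1) = r (x + n + n - 1)"
      using px n by (simp_all add: r'_def remove_window_def)
    ultimately show False
      using x(2) by simp
  qed
  then show ?thesis by (simp add: r'_def p_def)
qed

section \<open>The rank sequences of a monotone family\<close>

lemma a_coord_eq:
  assumes "n \<ge> 1"
  shows "a_coord n m i j = (m * (i * n + j)) div n"
proof -
  have "nat \<lfloor>real (j * m) / real n\<rfloor> = (j * m) div n"
    by (metis floor_divide_of_nat_eq nat_int)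
  moreover have "m * (i * n + j) = (m * i) * n + j * m"
    by (simp add: algebra_simps)
  ultimately show ?thesis
    using assms by (simp add: a_coord_def)
qed

lemma le_a_coord_iff:
  assumes "n \<ge> 1"
  shows "c \<le> int (a_coord n m i j) \<longleftrightarrow> int n * c \<le> int m * int (i * n + j)"
proof -
  have "int (a_coord n m i j) = (int m * int (i * n + j)) div int n"
    using assms by (simp add: a_coord_eq zdiv_int)
  moreover have "c \<le> k div int n \<longleftrightarrow> int n * c \<le> k" for k
  proof
    assume "c \<le> k div int n"
    then have "int n * c \<le> int n * (k div int n)"
      by (intro mult_left_mono) auto
    also have "\<dots> \<le> k"
      using assms mult_div_mod_eq[of "int n" k] pos_mod_sign[of "int n" k] by linarith
    finally show "int n * c \<le> k" .
  next
    assume "int n * c \<le> k"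
    then have "(int n * c) div int n \<le> k div int n"
      using assms by (intro zdiv_mono1) auto
    then show "c \<le> k div int n"
      using assms by simp
  qed
  ultimately show ?thesis by simp
qed

lemma rank_seq_rk_0:
  assumes y: "y \<in> Y d n m" and "d \<ge> 1" and n: "n \<ge> 1"
  shows "rank_seq n m (d * n) (rk d n m y 0)"
proof -
  have bounds: "0 \<le> y x" "int n * y x \<le> int m * int x" if "x < d * n" for x
  proof -
    have "y x \<in> {0..int (a_coord n m (x div n) (x mod n))}"
      using y that by (auto simp: Y_def PiE_iff)
    then show "0 \<le> y x" "int n * y x \<le> int m * int x"
      using le_a_coord_iff[OF n, of "y x" m "x div n" "x mod n"] by auto
  qed
  have "0 \<le> y 0" "int n * y 0 \<le> 0"
    using bounds[of 0] assms(2) n by auto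
  then have "y 0 = 0"
    using n by (simp add: mult_le_0_iff)
  moreover have "[int m * int x - int n * y x = int m * int x] (mod int n)" for x
    by (simp add: cong_iff_dvd_diff)
  moreover have "int n * y x \<le> int n * y (Suc x)" if "Suc x < d * n" for x
    using y that by (intro mult_left_mono) (auto simp: Y_def)
  ultimately show ?thesis
    using bounds by (auto simp: rank_seq_def algebra_simps)
qed

lemma rk_Suc_eq_remove_window:
  assumes "Suc u < d"
  shows "rk d n m y (d - u - 1) =
    remove_window n (move_index d n m y (Suc u)) (rk d n m y (d - Suc u - 1))"
proof -
  have "d - u - 1 = Suc (d - Suc u - 1)" and "d - Suc (d - Suc u - 1) = Suc u"
    using assms by auto
  then show ?thesis
    by (simp add: remove_window_def move_index_def fun_eq_iff)
qed

lemma rank_seq_rk: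
  assumes y: "y \<in> Y d n m" and n: "n \<ge> 1" and u: "u < d"
  shows "rank_seq n m (Suc u * n) (rk d n m y (d - u - 1))"
proof -
  have "u \<le> d - 1" using u by simp
  then show ?thesis
  proof (induction u rule: inc_induct)
    case base
    have "Suc (d - 1) = d" "d - (d - 1) - 1 = 0" using u by auto
    then show ?case
      using rank_seq_rk_0[OF y _ n] u by simp
  next
    case (step v)
    then have "rk d n m y (d - v - 1) =
      remove_window n (move_index d n m y (Suc v)) (rk d n m y (d - Suc v - 1))"
      by (intro rk_Suc_eq_remove_window) simp
    then show ?case
      using rank_seq_remove_window[OF step.IH n] by (simp add: move_index_def)
  qed
qed

lemma move_index_le:
  assumes "y \<in> Y d n m" and "n \<ge> 1" and "u < d"
  shows "move_index d n m y u \<le> u * n"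
  unfolding move_index_def using window_start_le[OF rank_seq_rk[OF assms] assms(2)] .

lemma move_index_Suc_less:
  assumes "y \<in> Y d n m" and "n \<ge> 1" and "Suc u < d"
  shows "move_index d n m y u < move_index d n m y (Suc u)"
  using window_start_remove_less[OF rank_seq_rk[OF assms] assms(2)]
    rk_Suc_eq_remove_window[OF assms(3), of n m y]
  by (simp add: move_index_def)

lemma move_index_strict_mono:
  assumes "y \<in> Y d n m" and "n \<ge> 1"
  shows "u < v \<Longrightarrow> v < d \<Longrightarrow> move_index d n m y u < move_index d n m y v"
proof (induction v)
  case (Suc v)
  then have "move_index d n m y u \<le> move_index d n m y v"
    by (cases "u = v") auto
  then show ?case
    using move_index_Suc_less[OF assms Suc.prems(2)] by simp
qed simp

section \<open>The permuted ranks are the removed windows\<close>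

lemma cycle_of_upt:
  assumes "a \<le> u"
  shows "cycle_of_list [a..<Suc u] i = (if i < a \<or> u < i then i else if i = u then a else Suc i)"
  using assms
proof (induction a rule: inc_induct)
  case base
  then show ?case by simp
next
  case (step a)
  then have "[a..<Suc u] = a # Suc a # [Suc (Suc a)..<Suc u]"
    "[Suc a..<Suc u] = Suc a # [Suc (Suc a)..<Suc u]"
    by (simp_all add: upt_conv_Cons)
  then have "cycle_of_list [a..<Suc u] i = transpose a (Suc a) (cycle_of_list [Suc a..<Suc u] i)"
    by simp
  then show ?case
    using step.IH step.hyps by (auto simp: transpose_def)
qed

lemma row_index_eq:
  assumes "n \<ge> 1" and "move_index d n m y u \<le> u * n"
    and "move_index d n m y u \<le> x" and "x < move_index d n m y u + n"
  shows "row_index d n m y (x mod n) u = x div n"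
  unfolding row_index_def
proof (rule Min_eqI)
  show "finite (row_set d n m y (x mod n) u)"
    by (simp add: row_set_def)
  have "x < Suc u * n"
    using assms by simp
  then have "x div n < Suc u"
    using assms(1) by (simp add: div_less_iff_less_mult)
  then show "x div n \<in> row_set d n m y (x mod n) u"
    using assms(3) by (simp add: row_set_def)
next
  fix i
  assume "i \<in> row_set d n m y (x mod n) u"
  then have i: "move_index d n m y u \<le> i * n + x mod n"
    by (simp add: row_set_def)
  show "x div n \<le> i"
  proof (rule ccontr)
    assume "\<not> x div n \<le> i"
    then have "Suc i * n \<le> (x div n) * n"
      by (intro mult_right_mono) auto
    moreover have "Suc i * n = i * n + n"
      by simp
    ultimately have "i * n + x mod n + n \<le> (x div n) * n + x mod n"
      by linarith
    also have "\<dots> = x"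
      by (rule div_mult_mod_eq)
    finally show False
      using i assms(4) by simp
  qed
qed

lemma row_set_nonempty:
  assumes "y \<in> Y d n m" and "n \<ge> 1" and "u < d"
  shows "row_set d n m y j u \<noteq> {}"
  using move_index_le[OF assms] by (auto simp: row_set_def intro!: exI[of _ u])

lemma row_index_props:
  assumes "y \<in> Y d n m" and "n \<ge> 1" and "u < d"
  shows "row_index d n m y j u \<le> u"
    and "row_index d n m y j u \<le> i \<Longrightarrow> move_index d n m y u \<le> i * n + j"
    and "i \<le> u \<Longrightarrow> move_index d n m y u \<le> i * n + j \<Longrightarrow> row_index d n m y j u \<le> i"
proof -
  have fin: "finite (row_set d n m y j u)"
    by (simp add: row_set_def)
  have "row_index d n m y j u \<in> row_set d n m y j u"
    unfolding row_index_def using fin row_set_nonempty[OF assms] by (rule Min_in)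
  then have *: "row_index d n m y j u \<le> u"
    "move_index d n m y u \<le> row_index d n m y j u * n + j"
    by (simp_all add: row_set_def)
  show "row_index d n m y j u \<le> u" by (fact *)
  show "move_index d n m y u \<le> i * n + j" if "row_index d n m y j u \<le> i"
    using *(2) mult_le_mono1[OF that, of n] by linarith
  show "row_index d n m y j u \<le> i" if "i \<le> u" "move_index d n m y u \<le> i * n + j"
    unfolding row_index_def using fin that by (intro Min_le) (auto simp: row_set_def)
qed

text \<open>The composite of the cycles at the levels \<open>d - 1, \<dots>, u\<close>, the outermost being level
  \<open>d - 1\<close>; the whole permutation is \<open>u = 1\<close>. The cuts are made in the order
  \<open>d - 1, \<dots>, 1\<close>, so this is the part that describes the cuts from the first down to level
  \<open>u\<close>.\<close>

definition s_tail :: "nat \<Rightarrow> nat \<Rightarrow> nat \<Rightarrow> (nat \<Rightarrow> int) \<Rightarrow> nat \<Rightarrow> nat \<Rightarrow> nat \<Rightarrow> nat" where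
  "s_tail d n m y j u = fold (\<lambda>v f. s_cycle d n m y j v \<circ> f) [u..<d] id"

lemma fold_comp_eq:
  fixes s :: "'b \<Rightarrow> 'a \<Rightarrow> 'a" and g :: "'a \<Rightarrow> 'a"
  shows "fold (\<lambda>v f. s v \<circ> f) vs g = fold (\<lambda>v f. s v \<circ> f) vs id \<circ> g"
proof (induction vs arbitrary: g)
  case (Cons v vs)
  show ?case
    using Cons[of "s v \<circ> g"] Cons[of "s v"] by (simp add: comp_assoc)
qed simp

lemma s_tail_Suc:
  assumes "u < d"
  shows "s_tail d n m y j u = s_tail d n m y j (Suc u) \<circ> s_cycle d n m y j u"
  using assms fold_comp_eq[of "s_cycle d n m y j" "[Suc u..<d]" "s_cycle d n m y j u"]
  by (simp add: s_tail_def upt_conv_Cons)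

lemma s_cycle_eq:
  assumes "y \<in> Y d n m" and "n \<ge> 1" and "u < d"
  shows "s_cycle d n m y j u i = (if i < row_index d n m y j u \<or> u < i then i
    else if i = u then row_index d n m y j u else Suc i)"
  unfolding s_cycle_def using row_index_props(1)[OF assms] by (rule cycle_of_upt)

text \<open>The cycle at level \<open>u\<close> is the reindexing of the class of \<open>j\<close> modulo \<open>n\<close> that results
  from the removal of one window: rows below the window stay, later rows move up by one,
  and the removed entry is parked in row \<open>u\<close>.\<close>

lemma rk_eq_rk_s_tail:
  assumes y: "y \<in> Y d n m" and n: "n \<ge> 1" and "u < d" and "i \<le> u"
  shows "rk d n m y (d - u - 1) (i * n + j) =
    rk d n m y 0 (s_tail d n m y j (Suc u) i * n + j)"
proof -
  have "u \<le> d - 1" using assms(3) by simp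
  then show ?thesis using \<open>i \<le> u\<close>
  proof (induction u arbitrary: i rule: inc_induct)
    case base
    then show ?case
      using assms(3) by (simp add: s_tail_def)
  next
    case (step v)
    define c where "c = s_cycle d n m y j (Suc v)"
    have v: "Suc v < d" using step.hyps by simp
    have c: "c i = (if i * n + j < move_index d n m y (Suc v) then i else Suc i)"
      using s_cycle_eq[OF y n v, of j i] step.prems
        row_index_props(2)[OF y n v, of j i] row_index_props(3)[OF y n v, of i j]
      by (auto simp: c_def not_less)
    have "rk d n m y (d - v - 1) (i * n + j) = rk d n m y (d - Suc v - 1) (c i * n + j)"
      unfolding rk_Suc_eq_remove_window[OF v] by (simp add: remove_window_def c algebra_simps)
    also have "\<dots> = rk d n m y 0 (s_tail d n m y j (Suc (Suc v)) (c i) * n + j)"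
      using c step.prems by (intro step.IH) auto
    finally show ?case
      using s_tail_Suc[OF v, of n m y j] by (simp add: c_def)
  qed
qed

text \<open>After its own step the entry parked in row \<open>u\<close> is never moved by the cycles of smaller
  level, so row \<open>u\<close> of the final array holds the window removed at level \<open>u\<close>.
  For \<open>u = 0\<close> the window is all that remains at the end.\<close>

lemma rk_s_perm_eq_window:
  assumes y: "y \<in> Y d n m" and n: "n \<ge> 1" and u: "u < d"
    and x: "move_index d n m y u \<le> x" "x < move_index d n m y u + n"
  shows "rk d n m y 0 (s_perm d n m y (x mod n) u * n + x mod n) = rk d n m y (d - u - 1) x"
proof -
  define j where "j = x mod n"
  have fixed: "s_tail d n m y j v u = s_tail d n m y j u u" if "v \<le> u" for v
    using that
  proof (induction v rule: inc_induct)
    case (step v)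
    then have v: "v < d" using u by simp
    show ?case
      using step s_cycle_eq[OF y n v, of j u] by (simp add: s_tail_Suc[OF v])
  qed simp
  have "s_perm d n m y j u = s_tail d n m y j (Suc u) (x div n)"
  proof (cases u)
    case 0
    then have "x div n = 0"
      using x(2) move_index_le[OF y n u] by simp
    then show ?thesis
      using 0 by (simp add: s_perm_def s_tail_def)
  next
    case (Suc u')
    have "s_perm d n m y j u = s_tail d n m y j u u"
      using fixed[of 1] Suc by (simp add: s_perm_def s_tail_def)
    also have "\<dots> = s_tail d n m y j (Suc u) (row_index d n m y j u)"
      using s_cycle_eq[OF y n u, of j u] row_index_props(1)[OF y n u, of j]
      by (simp add: s_tail_Suc[OF u])
    also have "row_index d n m y j u = x div n"
      unfolding j_def using row_index_eq[OF n move_index_le[OF y n u] x] .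
    finally show ?thesis .
  qed
  moreover have "x div n \<le> u"
  proof -
    have "x < Suc u * n"
      using x(2) move_index_le[OF y n u] by simp
    then show ?thesis
      using n by (simp add: div_less_iff_less_mult flip: less_Suc_eq_le)
  qed
  ultimately show ?thesis
    using rk_eq_rk_s_tail[OF y n u, of "x div n" j] by (simp add: j_def)
qed

lemma Psi_rank:
  "int n * Psi d n m y i j =
    int m * int (i * n + j) - rk d n m y 0 (s_perm d n m y j i * n + j)"
  by (simp add: Psi_def algebra_simps)

section \<open>Admissible sets from rank arrays\<close>

lemma residue_representative:
  assumes "coprime m n" and "n \<ge> (1 :: nat)"
  obtains x where "x < n" and "[m * x = q] (mod n)"
proof -
  obtain e where "[m * e = 1] (mod n)"
    using cong_solve_coprime_nat[OF assms(1)] by auto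
  then have "[m * e * q = 1 * q] (mod n)"
    by (intro cong_mult) auto
  then have "[m * (e * q mod n) = q] (mod n)"
    by (simp add: cong_def mod_mult_right_eq mult.assoc)
  moreover have "e * q mod n < n"
    using assms(2) by simp
  ultimately show ?thesis using that by blast
qed

text \<open>The rows of \<open>b\<close> are indexed cyclically, by the residue of \<open>x\<close> modulo \<open>n\<close>, so that
  closure of the set with generators \<open>d b\<^sub>i\<^sub>,\<^sub>j + i\<close> under adding \<open>dm\<close> reads the same at all
  columns. The assumption \<open>link\<close> is admissibility at the rows \<open>i < d - 1\<close>.\<close>

locale rank_array =
  fixes d n m :: nat and b :: "nat \<Rightarrow> nat \<Rightarrow> nat"
  assumes d_pos: "d \<ge> 1" and n_pos: "n \<ge> 1" and coprime: "coprime m n"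
    and residue: "i < d \<Longrightarrow> [b i x = m * x] (mod n)"
    and periodic: "b i x = b i (x mod n)"
    and zero: "b 0 0 = 0"
    and step: "i < d \<Longrightarrow> b i (Suc x) \<le> b i x + m"
    and link: "Suc i < d \<Longrightarrow> \<exists>x. b (Suc i) (Suc x) \<le> b i x + m"
begin

definition generators :: "nat set" where
  "generators = {d * b i j + i |i j. i < d \<and> j < n}"

definition progressions :: "nat set" where
  "progressions = (\<Union>a\<in>generators. {a + d * n * k |k. True})"

lemma periodic_cong: "[x = x'] (mod n) \<Longrightarrow> b i x = b i x'"
  by (metis cong_def periodic)

lemma steps: "i < d \<Longrightarrow> b i (x + k) \<le> b i x + k * m"
proof (induction k)
  case (Suc k)
  then show ?case
    using step[of i "x + k"] by simp
qed simp

text \<open>On the way from \<open>x\<close> to \<open>x + n\<close> one of the \<open>n\<close> steps can be taken at a position where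
  \<open>link\<close> changes to row \<open>i + 1\<close>. Each step costs at most \<open>m\<close>, and \<open>x + n\<close> is the same column
  as \<open>x\<close>.\<close>

lemma link_all:
  assumes "Suc i < d"
  shows "b (Suc i) x \<le> b i x + m * n"
proof -
  obtain x0 where x0: "b (Suc i) (Suc x0) \<le> b i x0 + m"
    using link[OF assms] by blast
  define k l where "k = (x0 + x * (n - 1)) mod n" and "l = n - 1 - k"
  have "k < n" using n_pos by (simp add: k_def)
  then have kl: "k + l + 1 = n" by (simp add: l_def)
  have "(x + k) mod n = (x + (x0 + x * (n - 1))) mod n"
    by (simp add: k_def mod_simps)
  also have "x + (x0 + x * (n - 1)) = x0 + x * n"
    using n_pos by (cases n) (simp_all add: algebra_simps)
  finally have "[x + k = x0] (mod n)"
    by (simp add: cong_def)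
  then have eqs: "b i (x + k) = b i x0" "b (Suc i) (Suc (x + k)) = b (Suc i) (Suc x0)"
    using cong_add[of "x + k" x0 n 1 1] by (auto intro!: periodic_cong)
  have "Suc (x + k) + l = x + n"
    using kl by simp
  then have "[x = Suc (x + k) + l] (mod n)"
    by (simp only: cong_def mod_add_self2)
  then have "b (Suc i) x = b (Suc i) (Suc (x + k) + l)"
    by (rule periodic_cong)
  also have "\<dots> \<le> b (Suc i) (Suc (x + k)) + l * m"
    by (rule steps[OF assms])
  also have "\<dots> \<le> b i (x + k) + m + l * m"
    using x0 eqs by simp
  also have "\<dots> \<le> b i x + k * m + m + l * m"
    using steps[of i x k] assms by simp
  also have "\<dots> = b i x + m * (k + l + 1)"
    by (simp add: algebra_simps)
  finally show ?thesis unfolding kl .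
qed

lemma le_position: "i < d \<Longrightarrow> b i x \<le> m * (i * n + x)"
proof (induction i)
  case 0
  then show ?case
    using steps[of 0 0 x] zero by (simp add: mult.commute)
next
  case (Suc i)
  then show ?case
    using link_all[of i x] by (simp add: algebra_simps)
qed

text \<open>Membership in the set depends only on the row \<open>i\<close> and the quotient \<open>q\<close>: the column is
  any \<open>x\<close> with \<open>mx\<close> congruent to \<open>q\<close>, not necessarily below \<open>n\<close>.\<close>

lemma progressionsI:
  assumes "i < d" and "[q = m * x] (mod n)" and "b i x \<le> q"
  shows "d * q + i \<in> progressions"
proof -
  have "[b i x = q] (mod n)"
    using residue[OF assms(1), of x] assms(2) by (simp add: cong_def)
  then have "n dvd q - b i x"
    using assms(3) by (simp add: cong_altdef_nat cong_sym_eq)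
  then obtain k where "q - b i x = n * k"
    by (rule dvdE)
  then have k: "q = b i x + n * k"
    using assms(3) by linarith
  have "d * b i (x mod n) + i \<in> generators"
    unfolding generators_def using assms(1) n_pos
    by (intro CollectI exI[of _ i] exI[of _ "x mod n"]) simp
  moreover have "d * q + i = (d * b i (x mod n) + i) + d * n * k"
    using k periodic[of i x] by (simp add: algebra_simps)
  ultimately show ?thesis
    unfolding progressions_def by blast
qed

lemma progressionsE:
  assumes "z \<in> progressions"
  obtains i x q where "z = d * q + i" "i < d" "[q = m * x] (mod n)" "b i x \<le> q"
proof -
  obtain i j k where z: "i < d" "j < n" "z = d * b i j + i + d * n * k"
    using assms by (auto simp: progressions_def generators_def)
  have "[b i j + n * k = m * j] (mod n)"
    using residue[OF z(1), of j] by (simp add: cong_def)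
  then show ?thesis
    using that[of "b i j + n * k" i j] z by (simp add: algebra_simps)
qed

lemma progressions_add_dn: "z \<in> progressions \<Longrightarrow> z + d * n \<in> progressions"
proof (elim progressionsE)
  fix i x q
  assume *: "z = d * q + i" "i < d" "[q = m * x] (mod n)" "b i x \<le> q"
  then have "d * (q + n) + i \<in> progressions"
    by (intro progressionsI[of _ _ x]) (auto simp: cong_def)
  then show ?thesis
    using * by (simp add: algebra_simps)
qed

lemma progressions_add_dm: "z \<in> progressions \<Longrightarrow> z + d * m \<in> progressions"
proof (elim progressionsE)
  fix i x q
  assume *: "z = d * q + i" "i < d" "[q = m * x] (mod n)" "b i x \<le> q"
  have "[q + m = m * Suc x] (mod n)"
    using cong_add[OF *(3), of m m] by (simp add: add.commute)
  moreover have "b i (Suc x) \<le> q + m"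
    using step[OF *(2), of x] *(4) by linarith
  ultimately have "d * (q + m) + i \<in> progressions"
    using *(2) by (intro progressionsI)
  then show ?thesis
    using *(1) by (simp add: distrib_left add.commute add.left_commute)
qed

text \<open>The quotients in row \<open>0\<close> include \<open>0\<close> and are closed under adding \<open>n\<close> and \<open>m\<close>, hence
  include every integer from \<open>mn\<close> on: such an integer exceeds the \<open>mx\<close>, \<open>x < n\<close>, in its
  residue class. Adding \<open>dmn + 1\<close> to an element of the last row lands among them.\<close>

lemma row_zero_cofinite:
  assumes "m * n \<le> q"
  shows "d * q \<in> progressions"
proof -
  obtain x where x: "x < n" "[m * x = q] (mod n)"
    using residue_representative[OF coprime n_pos] .
  have "b 0 x \<le> m * x"
    using le_position[of 0 x] d_pos by simp
  also have "\<dots> \<le> m * n"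
    using x(1) by simp
  finally have "d * q + 0 \<in> progressions"
    using x(2) d_pos assms by (intro progressionsI[of _ _ x]) (auto simp: cong_sym)
  then show ?thesis by simp
qed

lemma progressions_add_dmn1: "z \<in> progressions \<Longrightarrow> z + (d * m * n + 1) \<in> progressions"
proof (elim progressionsE)
  fix i x q
  assume *: "z = d * q + i" "i < d" "[q = m * x] (mod n)" "b i x \<le> q"
  show ?thesis
  proof (cases "Suc i < d")
    case True
    have "d * (q + m * n) + Suc i \<in> progressions"
      using link_all[OF True, of x] * True
      by (intro progressionsI[of _ _ x]) (auto simp: cong_def)
    then show ?thesis
      using * by (simp add: algebra_simps)
  next
    case False
    then have "d = Suc i" using *(2) by simp
    moreover have "d * (q + m * n + 1) \<in> progressions"
      by (intro row_zero_cofinite) simp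
    ultimately show ?thesis
      using *(1) by (simp add: algebra_simps)
  qed
qed

lemma progressions_add_Gam:
  assumes "g \<in> Gam d n m" and "z \<in> progressions"
  shows "g + z \<in> progressions"
proof -
  have iter: "w + k * h \<in> progressions"
    if "w \<in> progressions" and "\<And>v. v \<in> progressions \<Longrightarrow> v + h \<in> progressions" for w k h
    using that(1)
  proof (induction k)
    case (Suc k)
    then show ?case
      using that(2)[of "w + k * h"] by (simp add: algebra_simps)
  qed simp
  obtain \<alpha> \<beta> \<gamma> where g: "g = \<alpha> * (d * n) + \<beta> * (d * m) + \<gamma> * (d * m * n + 1)"
    using assms(1) by (auto simp: Gam_def)
  have "z + \<alpha> * (d * n) + \<beta> * (d * m) + \<gamma> * (d * m * n + 1) \<in> progressions"
    by (intro iter assms(2) progressions_add_dn progressions_add_dm progressions_add_dmn1)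
  then show ?thesis
    using g by (simp add: add.commute add.left_commute)
qed

lemma generator_residues_inject:
  assumes "i < d" "j < n" "i' < d" "j' < n"
    and "[d * b i j + i = d * b i' j' + i'] (mod d * n)"
  shows "i = i'" and "j = j'"
proof -
  have "[d * b i j + i = d * b i' j' + i'] (mod d)"
    using assms(5) by (rule cong_modulus_mult_nat)
  then show i: "i = i'"
    using assms(1,3) by (simp add: cong_def)
  have "[d * b i j = d * b i j'] (mod d * n)"
    using assms(5) by (simp add: i cong_add_rcancel_nat)
  then have "[b i j = b i j'] (mod n)"
    using d_pos by (simp add: cong_def mult_mod_right flip: mult_mod_right)
  then have "[m * j = m * j'] (mod n)"
    using residue[OF assms(1), of j] residue[OF assms(1), of j'] by (simp add: cong_def)
  then have "[j = j'] (mod n)"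
    using coprime by (simp add: cong_mult_lcancel_nat)
  then show "j = j'"
    using assms(2,4) by (simp add: cong_def)
qed

lemma is_generators_progressions: "is_generators (d * n) progressions generators"
  unfolding is_generators_def
proof
  show "disjoint_family_on (\<lambda>a. {a + d * n * k |k. True}) generators"
    unfolding disjoint_family_on_def
  proof (intro ballI impI)
    fix a a'
    assume "a \<in> generators" "a' \<in> generators" "a \<noteq> a'"
    then obtain i j i' j' where a: "i < d" "j < n" "i' < d" "j' < n"
      "a = d * b i j + i" "a' = d * b i' j' + i'"
      by (auto simp: generators_def)
    have "a + d * n * k \<noteq> a' + d * n * k'" for k k'
    proof
      assume "a + d * n * k = a' + d * n * k'"
      then have "[a = a'] (mod d * n)"
        by (metis cong_def mod_mult_self2)
      then show False
        using generator_residues_inject[OF a(1-4)] a(5,6) \<open>a \<noteq> a'\<close> by simp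
    qed
    then show "{a + d * n * k |k. True} \<inter> {a' + d * n * k |k. True} = {}"
      by auto
  qed
qed (simp add: progressions_def)

lemma admissible_row:
  assumes "i < d"
  obtains j where "j < n" and "d * b i j + i + d * m + 1 \<in> progressions"
proof (cases "Suc i < d")
  case True
  obtain x where x: "b (Suc i) (Suc x) \<le> b i x + m"
    using link[OF True] by blast
  have "[b i x + m = m * Suc x] (mod n)"
    using cong_add[OF residue[OF assms, of x], of m m] by (simp add: algebra_simps)
  then have "d * (b i x + m) + Suc i \<in> progressions"
    using x True by (intro progressionsI)
  then show ?thesis
    using that[of "x mod n"] n_pos periodic[of i x] by (simp add: algebra_simps)
next
  case False
  then have i: "Suc i = d" using assms by simp
  \<comment> \<open>The column \<open>j\<close> is chosen so that the new quotient \<open>b i j + m + 1\<close> is divisible by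
    \<open>n\<close>; any such number lies in row \<open>0\<close>, which contains \<open>0\<close>.\<close>
  obtain j where j: "j < n" "[m * j = (n - 1) * (m + 1)] (mod n)"
    using residue_representative[OF coprime n_pos] .
  have "[b i j + (m + 1) = (n - 1) * (m + 1) + (m + 1)] (mod n)"
    using residue[OF assms, of j] j(2) by (intro cong_add) (auto intro: cong_trans)
  also have "(n - 1) * (m + 1) + (m + 1) = n * (m + 1)"
    using n_pos by (cases n) (simp_all add: algebra_simps)
  finally have "[b i j + (m + 1) = m * 0] (mod n)"
    by (simp add: cong_def)
  then have "d * (b i j + (m + 1)) + 0 \<in> progressions"
    using zero d_pos by (intro progressionsI[of _ _ 0]) auto
  moreover have "d * (b i j + (m + 1)) + 0 = d * b i j + i + d * m + 1"
    using i by (simp add: distrib_left)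
  ultimately show ?thesis
    using that[OF j(1)] by simp
qed

lemma progressions_in_Adm: "progressions \<in> Adm d n m"
proof -
  have "d * 0 + 0 \<in> progressions"
    using zero d_pos by (intro progressionsI[of _ _ 0]) auto
  moreover have "\<exists>a\<in>generators. [a = i] (mod d) \<and> a + d * m + 1 \<in> progressions"
    if i: "i < d" for i
  proof -
    obtain j where "j < n" "d * b i j + i + d * m + 1 \<in> progressions"
      using admissible_row[OF i] .
    then show ?thesis
      using i by (intro bexI[of _ "d * b i j + i"]) (auto simp: cong_def generators_def)
  qed
  ultimately show ?thesis
    using progressions_add_Gam is_generators_progressions by (auto simp: Adm_def)
qed

lemma progressions_has_coords:
  assumes c: "\<And>i j. i < d \<Longrightarrow> j < n \<Longrightarrow>
    int n * c i j = int m * int (i * n + j) - int (b i j)"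
  shows "has_coords d n m progressions c"
proof -
  have "0 \<le> c i j \<and> c i j \<le> int (a_coord n m i j)" if "i < d" "j < n" for i j
  proof -
    have "int (b i j) \<le> int (m * (i * n + j))"
      using le_position[OF that(1), of j] by (subst zle_int)
    then have "0 \<le> int n * c i j" "int n * c i j \<le> int m * int (i * n + j)"
      using c[OF that] by simp_all
    then show ?thesis
      using n_pos le_a_coord_iff[OF n_pos] by (simp add: zero_le_mult_iff)
  qed
  moreover have "int ` generators = {int (a_hat d n m i j) - int (d * n) * c i j |i j. i < d \<and> j < n}"
  proof -
    have "int (d * b i j + i) = int (a_hat d n m i j) - int (d * n) * c i j"
      if "i < d" "j < n" for i j
    proof -
      have "int (d * n) * c i j = int d * (int m * int (i * n + j) - int (b i j))"
        using c[OF that] by (simp add: mult.assoc)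
      then show ?thesis
        by (simp add: a_hat_def algebra_simps)
    qed
    then show ?thesis
      unfolding generators_def by (force simp: image_iff)
  qed
  ultimately show ?thesis
    using is_generators_progressions unfolding has_coords_def by blast
qed

end

lemma has_coords_unique:
  assumes "has_coords d n m \<Delta> c" and "has_coords d n m \<Delta>' c"
  shows "\<Delta> = \<Delta>'"
proof -
  obtain A A' where "is_generators (d * n) \<Delta> A" "is_generators (d * n) \<Delta>' A'" "int ` A = int ` A'"
    using assms unfolding has_coords_def by metis
  then show ?thesis
    by (simp add: is_generators_def inj_image_eq_iff)
qed

section \<open>The rank array of a monotone family\<close>

text \<open>The rows of the permuted array of ranks, extended with period \<open>n\<close> to all \<open>x\<close>, so that
  row \<open>u\<close> can be compared with a rank family at the positions of a window.\<close>

definition window_rank :: "nat \<Rightarrow> nat \<Rightarrow> nat \<Rightarrow> (nat \<Rightarrow> int) \<Rightarrow> nat \<Rightarrow> nat \<Rightarrow> int" where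
  "window_rank d n m y u x = rk d n m y 0 (s_perm d n m y (x mod n) u * n + x mod n)"

lemma window_rank_eq:
  assumes "y \<in> Y d n m" and "n \<ge> 1" and "u < d"
    and "move_index d n m y u \<le> x" "x < move_index d n m y u + n"
  shows "window_rank d n m y u x = rk d n m y (d - u - 1) x"
  unfolding window_rank_def using assms by (rule rk_s_perm_eq_window)

lemma window_rank_periodic: "window_rank d n m y u (x mod n) = window_rank d n m y u x"
  by (simp add: window_rank_def)

lemma window_rank_cong:
  "[x = x'] (mod n) \<Longrightarrow> window_rank d n m y u x = window_rank d n m y u x'"
  by (simp add: window_rank_def cong_def)

lemma window_representative:
  assumes "n \<ge> (1 :: nat)"
  obtains z where "p \<le> z" "z < p + n" "[z = x] (mod n)"
proof -
  have "(p + (x + p * (n - 1)) mod n) mod n = (p + (x + p * (n - 1))) mod n"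
    by (simp add: mod_simps)
  also have "p + (x + p * (n - 1)) = x + p * n"
    using assms by (cases n) (simp_all add: algebra_simps)
  finally have "[p + (x + p * (n - 1)) mod n = x] (mod n)"
    by (simp add: cong_def)
  then show ?thesis
    using that[of "p + (x + p * (n - 1)) mod n"] assms by simp
qed

lemma window_rank_nonneg_cong:
  assumes y: "y \<in> Y d n m" and n: "n \<ge> 1" and u: "u < d"
  shows "0 \<le> window_rank d n m y u x"
    and "[window_rank d n m y u x = int m * int x] (mod int n)"
proof -
  obtain z where z: "move_index d n m y u \<le> z" "z < move_index d n m y u + n" "[z = x] (mod n)"
    using window_representative[OF n] .
  have zL: "z < Suc u * n"
    using z(2) move_index_le[OF y n u] by simp
  have eq: "window_rank d n m y u x = rk d n m y (d - u - 1) z"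
    using window_rank_eq[OF y n u z(1,2)] window_rank_cong[OF z(3), of d m y u] by simp
  show "0 \<le> window_rank d n m y u x"
    unfolding eq using rank_seq_rk[OF y n u] zL by (rule rank_seq_nonneg)
  have "[rk d n m y (d - u - 1) z = int m * int z] (mod int n)"
    using rank_seq_rk[OF y n u] zL by (rule rank_seq_cong)
  also have "[int m * int z = int m * int x] (mod int n)"
    using z(3) by (intro cong_mult) (auto simp: cong_int_iff)
  finally show "[window_rank d n m y u x = int m * int x] (mod int n)"
    unfolding eq .
qed

text \<open>Inside the window this is the step bound of the rank sequence; from the last position
  of the window back to the first one it is the membership of \<open>p\<^sub>u\<close> in the move set.\<close>

lemma window_rank_Suc:
  assumes y: "y \<in> Y d n m" and n: "n \<ge> 1" and u: "u < d"
  shows "window_rank d n m y u (Suc x) \<le> window_rank d n m y u x + int m"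
proof -
  define p where "p = move_index d n m y u"
  obtain z where z: "p \<le> z" "z < p + n" "[z = x] (mod n)"
    using window_representative[OF n] .
  have "[Suc z = Suc x] (mod n)"
    using cong_add[OF z(3), of 1 1] by simp
  then have eqs: "window_rank d n m y u x = window_rank d n m y u z"
    "window_rank d n m y u (Suc x) = window_rank d n m y u (Suc z)"
    using z(3) by (auto intro: window_rank_cong cong_sym)
  have wz: "window_rank d n m y u z = rk d n m y (d - u - 1) z"
    using z by (intro window_rank_eq[OF y n u]) (auto simp: p_def)
  show ?thesis
  proof (cases "Suc z < p + n")
    case True
    then have "Suc z < Suc u * n"
      using move_index_le[OF y n u] by (simp add: p_def)
    moreover have "window_rank d n m y u (Suc z) = rk d n m y (d - u - 1) (Suc z)"
      using z True by (intro window_rank_eq[OF y n u]) (auto simp: p_def)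
    ultimately show ?thesis
      using rank_seq_Suc[OF rank_seq_rk[OF y n u]] wz eqs by simp
  next
    case False
    then have Sz: "Suc z = p + n" using z(2) by simp
    have "window_rank d n m y u (Suc z) = window_rank d n m y u p"
      by (rule window_rank_cong) (simp add: Sz cong_def)
    also have "\<dots> = rk d n m y (d - u - 1) p"
      using n by (intro window_rank_eq[OF y n u]) (auto simp: p_def)
    also have "\<dots> \<le> rk d n m y (d - u - 1) (p + n - 1) + int m"
      using window_start_in_move_set[OF rank_seq_rk[OF y n u] n]
      by (simp add: move_set_def p_def move_index_def)
    also have "p + n - 1 = z" using Sz by simp
    finally show ?thesis
      using wz eqs by simp
  qed
qed

text \<open>Let \<open>p\<close> be the start of the window at level \<open>u + 1\<close>. The entry just before it
  survives the removal and satisfies \<open>r p \<le> r (p - 1) + m\<close>. The window at level \<open>u\<close>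
  starts before \<open>p\<close>, and its entry in the class of \<open>p - 1\<close> is at least as large as the entry
  at \<open>p - 1\<close>, as ranks decrease along the classes modulo \<open>n\<close> from the start of the window
  on.\<close>

lemma window_rank_link:
  assumes y: "y \<in> Y d n m" and n: "n \<ge> 1" and u: "Suc u < d"
  shows "\<exists>x. window_rank d n m y (Suc u) (Suc x) \<le> window_rank d n m y u x + int m"
proof -
  define p q where "p = move_index d n m y (Suc u)" and "q = move_index d n m y u"
  define r r' where "r = rk d n m y (d - Suc u - 1)" and "r' = rk d n m y (d - u - 1)"
  have u': "u < d" using u by simp
  have r: "rank_seq n m (Suc (Suc u) * n) r" and r': "rank_seq n m (Suc u * n) r'"
    unfolding r_def r'_def by (rule rank_seq_rk[OF y n u] rank_seq_rk[OF y n u'])+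
  have "q < p"
    unfolding p_def q_def by (rule move_index_Suc_less[OF y n u])
  then obtain x where x: "p = Suc x" "q \<le> x"
    by (cases p) auto
  have pL: "p \<le> Suc u * n"
    unfolding p_def by (rule move_index_le[OF y n u])
  obtain z where z: "q \<le> z" "z < q + n" "[z = x] (mod n)"
    using window_representative[OF n] .
  have "z \<le> x"
  proof (rule ccontr)
    assume "\<not> z \<le> x"
    then have "x < z" by simp
    moreover have "n dvd z - x"
      using z(3) \<open>x < z\<close> by (simp add: cong_altdef_nat)
    ultimately have "n \<le> z - x"
      by (intro dvd_imp_le) auto
    then show False
      using z(2) x(2) \<open>x < z\<close> by simp
  qed
  then obtain k where "x - z = n * k"
    using z(3) by (metis cong_altdef_nat cong_sym dvdE)
  then have k: "x = z + k * n"
    using \<open>z \<le> x\<close> by (simp add: mult.commute)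
  have "window_rank d n m y (Suc u) (Suc x) = r p"
    unfolding x(1)[symmetric] r_def
    using n by (intro window_rank_eq[OF y n u]) (auto simp: p_def)
  also have "\<dots> \<le> r x + int m"
    unfolding x(1) using x(1) pL n by (intro rank_seq_Suc[OF r]) auto
  also have "r x = r' x"
    using rk_Suc_eq_remove_window[OF u, of n m y] x(1)
    by (simp add: r_def r'_def p_def remove_window_def)
  also have "r' x \<le> r' z"
    unfolding k using k x(1) pL z(1)
    by (intro rank_decreases_by_periods[OF r' n]) (auto simp: q_def r'_def move_index_def)
  also have "r' z = window_rank d n m y u z"
    unfolding r'_def using z by (intro window_rank_eq[OF y n u', symmetric]) (auto simp: q_def)
  also have "\<dots> = window_rank d n m y u x"
    using z(3) by (rule window_rank_cong)
  finally show ?thesis by auto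
qed

lemma window_rank_zero:
  assumes y: "y \<in> Y d n m" and "d \<ge> 1" and n: "n \<ge> 1"
  shows "window_rank d n m y 0 0 = 0"
proof -
  have d: "0 < d" using assms(2) by simp
  have "window_rank d n m y 0 0 = rk d n m y (d - 0 - 1) 0"
    using n move_index_le[OF y n d] by (intro window_rank_eq[OF y n d]) auto
  then show ?thesis
    using rank_seq_zero[OF rank_seq_rk[OF y n d]] by simp
qed

lemma rank_array_window_rank:
  assumes y: "y \<in> Y d n m" and d: "d \<ge> 1" and n: "n \<ge> 1" and "coprime m n"
  shows "rank_array d n m (\<lambda>u x. nat (window_rank d n m y u x))"
proof
  fix u x
  assume u: "u < d"
  have "[int (nat (window_rank d n m y u x)) = int (m * x)] (mod int n)"
    using window_rank_nonneg_cong[OF y n u, of x] by simp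
  then show "[nat (window_rank d n m y u x) = m * x] (mod n)"
    by (simp only: cong_int_iff)
  show "nat (window_rank d n m y u (Suc x)) \<le> nat (window_rank d n m y u x) + m"
    using window_rank_Suc[OF y n u, of x] window_rank_nonneg_cong(1)[OF y n u] by simp
next
  fix u
  assume u: "Suc u < d"
  obtain x where "window_rank d n m y (Suc u) (Suc x) \<le> window_rank d n m y u x + int m"
    using window_rank_link[OF y n u] by blast
  then show "\<exists>x. nat (window_rank d n m y (Suc u) (Suc x)) \<le> nat (window_rank d n m y u x) + m"
    using window_rank_nonneg_cong(1)[OF y n, of u x] u by (intro exI[of _ x]) simp
qed (use assms in \<open>simp_all add: window_rank_periodic window_rank_zero\<close>)

lemma ex1_Adm_Psi:
  assumes y: "y \<in> Y d n m" and "d \<ge> 1" and n: "n \<ge> 1" and "coprime m n"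
  shows "\<exists>!\<Delta>. \<Delta> \<in> Adm d n m \<and> has_coords d n m \<Delta> (Psi d n m y)"
proof -
  interpret rank_array d n m "\<lambda>u x. nat (window_rank d n m y u x)"
    by (rule rank_array_window_rank[OF assms])
  have "has_coords d n m progressions (Psi d n m y)"
  proof (rule progressions_has_coords)
    fix i j
    assume "i < d" "j < n"
    then show "int n * Psi d n m y i j =
      int m * int (i * n + j) - int (nat (window_rank d n m y i j))"
      using window_rank_nonneg_cong(1)[OF y n, of i j] Psi_rank[of n d m y i j]
      by (simp add: window_rank_def)
  qed
  then show ?thesis
    using progressions_in_Adm has_coords_unique by blast
qed

theorem proposition4p4:
  fixes d n m :: nat
  assumes "d \<ge> 1" and "n \<ge> 1" and "m > n" and "coprime m n"
  shows
    "(\<forall>y\<in>Y d n m.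
        (\<forall>u\<in>{1..d - 1}. move_set n m u (rk d n m y (d - u - 1)) \<noteq> {}) \<and>
        (\<forall>u\<in>{1..d - 1}. 0 < move_index d n m y u \<and> move_index d n m y u \<le> (d - 1) * n) \<and>
        strict_mono_on {1..d - 1} (move_index d n m y))
   \<and> (\<forall>y\<in>Y d n m.
        (\<forall>u\<in>{1..d - 1}. \<forall>j<n. row_set d n m y j u \<noteq> {}) \<and>
        (\<exists>!\<Delta>. \<Delta> \<in> Adm d n m \<and> has_coords d n m \<Delta> (Psi d n m y)))
   \<and> (\<forall>y\<in>Y d n m. \<forall>u\<in>{1..d - 1}. \<forall>x.
        move_index d n m y u \<le> x \<and> x < u * n \<longrightarrow>
          rk d n m y (d - u - 1) x > rk d n m y (d - u - 1) (x + n))"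
proof (intro conjI ballI allI impI)
  fix y u
  assume y: "y \<in> Y d n m" and "u \<in> {1..d - 1}"
  then have u: "u < d" "1 \<le> u" "u \<le> d - 1" by auto
  note r = rank_seq_rk[OF y assms(2) u(1)]
  show "move_set n m u (rk d n m y (d - u - 1)) \<noteq> {}"
    using zero_in_move_set[OF r assms(2)] by blast
  show "0 < move_index d n m y u"
    unfolding move_index_def by (rule window_start_pos[OF r assms(2) u(2)])
  show "move_index d n m y u \<le> (d - 1) * n"
    using move_index_le[OF y assms(2) u(1)] mult_le_mono1[OF u(3), of n] by (rule order_trans)
  show "row_set d n m y j u \<noteq> {}" for j
    by (rule row_set_nonempty[OF y assms(2) u(1)])
  show "rk d n m y (d - u - 1) (x + n) < rk d n m y (d - u - 1) x"
    if "move_index d n m y u \<le> x \<and> x < u * n" for x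
    using that by (intro rank_decreases_by_period[OF r assms(2)]) (auto simp: move_index_def)
next
  fix y
  assume y: "y \<in> Y d n m"
  show "strict_mono_on {1..d - 1} (move_index d n m y)"
    using move_index_strict_mono[OF y assms(2)] by (auto intro!: strict_mono_onI)
  show "\<exists>!\<Delta>. \<Delta> \<in> Adm d n m \<and> has_coords d n m \<Delta> (Psi d n m y)"
    by (rule ex1_Adm_Psi[OF y assms(1,2,4)])
qed

end
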